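(* Let $f_a(\ddot q,\dot q,q,t)$, $a=1,\dots,n$, be smooth functions, and let $$r_{ab}=\frac{\partial f_a}{\partial q^b}-\frac{\partial f_b}{\partial q^a}+\frac12\frac{d}{dt}\left(\frac{\partial f_b}{\partial \dot q^a}-\frac{\partial f_a}{\partial \dot q^b}\right),\qquad s_{ab}=\frac12\left(\frac{\partial f_a}{\partial \dot q^b}+\frac{\partial f_b}{\partial \dot q^a}\right)-\frac{d}{dt}\left(\frac{\partial f_b}{\partial \ddot q^a}\right).$$ Then the following two sets of conditions are equivalent. (A) For all $a,b$ the functions $r_{ab}$ and $s_{ab}$ are of first order, and for all $a,b,c$ $$\frac{\partial f_a}{\partial \ddot q^b}=\frac{\partial f_b}{\partial \ddot q^a},\qquad \frac{\partial r_{ab}}{\partial \dot q^c}=\frac{\partial s_{ac}}{\partial q^b}-\frac{\partial s_{bc}}{\partial q^a}.$$ (B) $f_a=g_{ab}\ddot q^b+h_a$ for some smooth first-order functions $g_{ab}$, $h_a$ with $g_{ab}=g_{ba}$ which satisfy, for all $a,b,c$, $$\frac{\partial g_{ab}}{\partial \dot q^c}-\frac{\partial g_{ac}}{\partial \dot q^b}=0,$$ $$\frac{\partial^2 h_a}{\partial \dot q^b\partial \dot q^c}-\frac{\partial^2 h_b}{\partial \dot q^a\partial \dot q^c}=2\left(\frac{\partial g_{ac}}{\partial q^b}-\frac{\partial g_{bc}}{\partial q^a}\right),$$ $$\sum_{a,b,c}\left(\frac{\partial^2 h_a}{\partial q^b\partial \dot q^c}-\frac{\partial^2 h_a}{\partial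 q^c\partial \dot q^b}\right)=0,$$ where $\sum_{a,b,c}$ denotes the cyclic sum over $a,b,c$.
   Context: Indices $a,b,c$ run over $1,\dots,n$ and repeated indices are summed (except that $\sum_{a,b,c}$ denotes, for fixed $a,b,c$, the sum of the three terms obtained by cyclically permuting $(a,b,c)$). The variables $q=(q^a)$ (generalized coordinates), $\dot q=(\dot q^a)$, $\ddot q=(\ddot q^a)$, $\dddot q=(\dddot q^a)$ and $t$ are independent (jet) coordinates; $q$ ranges over an open set $U\subseteq\mathbb{R}^n$, $t$ over an open interval $I\subseteq\mathbb{R}$, and $\dot q,\ddot q,\dddot q$ each over all of $\mathbb{R}^n$. All functions are smooth ($C^\infty$). The total time derivative is $$\frac{d}{dt}=\frac{\partial}{\partial t}+\dot q^c\frac{\partial}{\partial q^c}+\ddot q^c\frac{\partial}{\partial \dot q^c}+\dddot q^c\frac{\partial}{\partial \ddot q^c},$$ so that for $f_a$ depending on $(\ddot q,\dot q,q,t)$ the functions $r_{ab}$, $s_{ab}$ a priori depend on $(\dddot q,\ddot q,\dot q,q,t)$. A function is said to be of first order if it depends only on $(\dot q,q,t)$, i.e. is independent of $\ddot q$ and $\dddot q$. *)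

theory Defs
  imports "HOL-Analysis.Analysis"
begin

text \<open>
  Jet variables are written \<open>q\<close>, \<open>v\<close>, \<open>w\<close>, \<open>z\<close> for the generalized coordinates and their first,
  second and third time derivatives, with \<open>t\<close> for time. Functions take them in decreasing
  order of derivative: \<open>f w v q t\<close> for a function of second order, \<open>F z w v q t\<close> for one of
  third order.
\<close>

text \<open>
  \<open>Ck_on\<close> and \<open>smooth_on\<close> are meant for open \<open>S\<close>, on which the unrestricted derivative at a point of \<open>S\<close>
  depends only on the values of the function in \<open>S\<close>.
\<close>

fun Ck_on :: "nat \<Rightarrow> 'a::real_normed_vector set \<Rightarrow> ('a \<Rightarrow> 'b::real_normed_vector) \<Rightarrow> bool" where
  "Ck_on 0 S F \<longleftrightarrow> continuous_on S F"
| "Ck_on (Suc k) S F \<longleftrightarrow>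
     (\<forall>x\<in>S. F differentiable (at x)) \<and> (\<forall>e. Ck_on k S (\<lambda>x. frechet_derivative F (at x) e))"

definition smooth_on :: "'a::real_normed_vector set \<Rightarrow> ('a \<Rightarrow> 'b::real_normed_vector) \<Rightarrow> bool" where
  "smooth_on S F \<longleftrightarrow> (\<forall>k. Ck_on k S F)"

definition partial :: "'n::finite \<Rightarrow> (real^'n \<Rightarrow> real) \<Rightarrow> real^'n \<Rightarrow> real" where
  "partial b F x = deriv (\<lambda>s. F (x + s *\<^sub>R axis b 1)) 0"

definition total_deriv ::
  "(real^'n::finite \<Rightarrow> real^'n \<Rightarrow> real^'n \<Rightarrow> real \<Rightarrow> real) \<Rightarrow>
    real^'n \<Rightarrow> real^'n \<Rightarrow> real^'n \<Rightarrow> real^'n \<Rightarrow> real \<Rightarrow> real" where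
  "total_deriv F z w v q t =
     deriv (\<lambda>t'. F w v q t') t
     + (\<Sum>c\<in>UNIV. v $ c * partial c (\<lambda>q'. F w v q' t) q)
     + (\<Sum>c\<in>UNIV. w $ c * partial c (\<lambda>v'. F w v' q t) v)
     + (\<Sum>c\<in>UNIV. z $ c * partial c (\<lambda>w'. F w' v q t) w)"

definition r_fun ::
  "('n::finite \<Rightarrow> real^'n \<Rightarrow> real^'n \<Rightarrow> real^'n \<Rightarrow> real \<Rightarrow> real) \<Rightarrow> 'n \<Rightarrow> 'n \<Rightarrow>
    real^'n \<Rightarrow> real^'n \<Rightarrow> real^'n \<Rightarrow> real^'n \<Rightarrow> real \<Rightarrow> real" where
  "r_fun f a b z w v q t =
     partial b (\<lambda>q'. f a w v q' t) q - partial a (\<lambda>q'. f b w v q' t) q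
     + 1 / 2 * total_deriv
         (\<lambda>w v q t. partial a (\<lambda>v'. f b w v' q t) v - partial b (\<lambda>v'. f a w v' q t) v) z w v q t"

definition s_fun ::
  "('n::finite \<Rightarrow> real^'n \<Rightarrow> real^'n \<Rightarrow> real^'n \<Rightarrow> real \<Rightarrow> real) \<Rightarrow> 'n \<Rightarrow> 'n \<Rightarrow>
    real^'n \<Rightarrow> real^'n \<Rightarrow> real^'n \<Rightarrow> real^'n \<Rightarrow> real \<Rightarrow> real" where
  "s_fun f a b z w v q t =
     1 / 2 * (partial b (\<lambda>v'. f a w v' q t) v + partial a (\<lambda>v'. f b w v' q t) v)
     - total_deriv (\<lambda>w v q t. partial a (\<lambda>w'. f b w' v q t) w) z w v q t"

definition first_order ::
  "(real^'n::finite) set \<Rightarrow> real set \<Rightarrow>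
    (real^'n \<Rightarrow> real^'n \<Rightarrow> real^'n \<Rightarrow> real^'n \<Rightarrow> real \<Rightarrow> real) \<Rightarrow> bool" where
  "first_order U I F \<longleftrightarrow>
     (\<forall>z w z' w' v. \<forall>q\<in>U. \<forall>t\<in>I. F z w v q t = F z' w' v q t)"

definition condition_A ::
  "(real^'n::finite) set \<Rightarrow> real set \<Rightarrow>
    ('n \<Rightarrow> real^'n \<Rightarrow> real^'n \<Rightarrow> real^'n \<Rightarrow> real \<Rightarrow> real) \<Rightarrow> bool" where
  "condition_A U I f \<longleftrightarrow>
     (\<forall>a b. first_order U I (r_fun f a b) \<and> first_order U I (s_fun f a b)) \<and>
     (\<forall>a b w v. \<forall>q\<in>U. \<forall>t\<in>I.
        partial b (\<lambda>w'. f a w' v q t) w = partial a (\<lambda>w'. f b w' v q t) w) \<and>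
     (\<forall>a b c z w v. \<forall>q\<in>U. \<forall>t\<in>I.
        partial c (\<lambda>v'. r_fun f a b z w v' q t) v =
        partial b (\<lambda>q'. s_fun f a c z w v q' t) q - partial a (\<lambda>q'. s_fun f b c z w v q' t) q)"

definition cyclic_sum :: "('n \<Rightarrow> 'n \<Rightarrow> 'n \<Rightarrow> real) \<Rightarrow> 'n \<Rightarrow> 'n \<Rightarrow> 'n \<Rightarrow> real" where
  "cyclic_sum T a b c = T a b c + T b c a + T c a b"

definition condition_B ::
  "(real^'n::finite) set \<Rightarrow> real set \<Rightarrow>
    ('n \<Rightarrow> real^'n \<Rightarrow> real^'n \<Rightarrow> real^'n \<Rightarrow> real \<Rightarrow> real) \<Rightarrow> bool" where
  "condition_B U I f \<longleftrightarrow>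
     (\<exists>(g :: 'n \<Rightarrow> 'n \<Rightarrow> real^'n \<Rightarrow> real^'n \<Rightarrow> real \<Rightarrow> real)
       (h :: 'n \<Rightarrow> real^'n \<Rightarrow> real^'n \<Rightarrow> real \<Rightarrow> real).
        (\<forall>a b. smooth_on (UNIV \<times> U \<times> I) (\<lambda>(v, q, t). g a b v q t)) \<and>
        (\<forall>a. smooth_on (UNIV \<times> U \<times> I) (\<lambda>(v, q, t). h a v q t)) \<and>
        (\<forall>a w v. \<forall>q\<in>U. \<forall>t\<in>I. f a w v q t = (\<Sum>b\<in>UNIV. g a b v q t * w $ b) + h a v q t) \<and>
        (\<forall>a b v. \<forall>q\<in>U. \<forall>t\<in>I. g a b v q t = g b a v q t) \<and>
        (\<forall>a b c v. \<forall>q\<in>U. \<forall>t\<in>I.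
           partial c (\<lambda>v'. g a b v' q t) v - partial b (\<lambda>v'. g a c v' q t) v = 0) \<and>
        (\<forall>a b c v. \<forall>q\<in>U. \<forall>t\<in>I.
           partial b (\<lambda>v'. partial c (\<lambda>v''. h a v'' q t) v') v
           - partial a (\<lambda>v'. partial c (\<lambda>v''. h b v'' q t) v') v =
           2 * (partial b (\<lambda>q'. g a c v q' t) q - partial a (\<lambda>q'. g b c v q' t) q)) \<and>
        (\<forall>a b c v. \<forall>q\<in>U. \<forall>t\<in>I.
           cyclic_sum (\<lambda>a b c.
             partial b (\<lambda>q'. partial c (\<lambda>v'. h a v' q' t) v) q
             - partial c (\<lambda>q'. partial b (\<lambda>v'. h a v' q' t) v) q) a b c = 0))"

end

theory Submission
  imports Defs
begin

text \<open>
  The only dependence of \<open>s\<^sub>a\<^sub>b\<close> on \<open>z\<close> is the term \<open>- z\<^sup>c \<partial>\<^sup>2f\<^sub>b/\<partial>w\<^sup>c\<partial>w\<^sup>a\<close>, so (A) makes \<open>f\<close> affine in \<open>w\<close>. For an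
  affine \<open>f = g w + h\<close> with symmetric \<open>g\<close>, the \<open>z\<close>-coefficient of \<open>r\<^sub>a\<^sub>b\<close> is half of
  \<open>\<partial>g\<^sub>b\<^sub>c/\<partial>v\<^sup>a - \<partial>g\<^sub>a\<^sub>c/\<partial>v\<^sup>b\<close>; once it vanishes, \<open>s\<^sub>a\<^sub>b\<close> is of first order, and the \<open>w\<close>-coefficient of \<open>r\<^sub>a\<^sub>b\<close>
  vanishes iff the second condition of (B) holds. Under these two conditions the second one, differentiated
  along \<open>\<partial>/\<partial>t + v\<^sup>c \<partial>/\<partial>q\<^sup>c\<close>, cancels all terms with this derivative in the last condition of (A), and what
  remains is half the cyclic sum.
\<close>

section \<open>Directional derivatives of smooth functions\<close>

text \<open>
  Stated through one-dimensional restrictions, so that \<open>partial\<close> and \<open>deriv\<close> are instances of it without any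
  differentiability assumption.
\<close>

definition dirD :: "'a::real_normed_vector \<Rightarrow> ('a \<Rightarrow> real) \<Rightarrow> 'a \<Rightarrow> real" where
  "dirD e F x = deriv (\<lambda>s. F (x + s *\<^sub>R e)) 0"

lemma has_real_derivative_along_line:
  fixes F :: "'a::real_normed_vector \<Rightarrow> real"
  assumes "F differentiable at (x + s *\<^sub>R e)"
  shows "((\<lambda>s. F (x + s *\<^sub>R e)) has_real_derivative frechet_derivative F (at (x + s *\<^sub>R e)) e) (at s)"
proof -
  have "((\<lambda>s. x + s *\<^sub>R e) has_derivative (\<lambda>h. h *\<^sub>R e)) (at s)"
    by (auto intro!: derivative_eq_intros)
  moreover have D: "(F has_derivative frechet_derivative F (at (x + s *\<^sub>R e))) (at (x + s *\<^sub>R e))"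
    using assms frechet_derivative_works by blast
  ultimately have "((\<lambda>s. F (x + s *\<^sub>R e)) has_derivative
      (\<lambda>h. frechet_derivative F (at (x + s *\<^sub>R e)) (h *\<^sub>R e))) (at s)"
    by (rule has_derivative_compose)
  moreover have "frechet_derivative F (at (x + s *\<^sub>R e)) (h *\<^sub>R e)
      = frechet_derivative F (at (x + s *\<^sub>R e)) e * h" for h
    using linear_scale[OF has_derivative_linear[OF D]] by simp
  ultimately show ?thesis by (simp add: has_field_derivative_def)
qed

lemma dirD_eq_frechet_derivative:
  fixes F :: "'a::real_normed_vector \<Rightarrow> real"
  assumes "F differentiable at x"
  shows "dirD e F x = frechet_derivative F (at x) e"
  using has_real_derivative_along_line[of F x 0 e] assms
  by (simp add: dirD_def DERIV_imp_deriv)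

lemma DERIV_dirD:
  fixes F :: "'a::real_normed_vector \<Rightarrow> real"
  assumes "F differentiable at (x + s *\<^sub>R e)"
  shows "((\<lambda>s. F (x + s *\<^sub>R e)) has_real_derivative dirD e F (x + s *\<^sub>R e)) (at s)"
  using has_real_derivative_along_line[OF assms] dirD_eq_frechet_derivative[OF assms] by simp

lemma dirD_eqI:
  fixes F :: "'a::real_normed_vector \<Rightarrow> real"
  assumes "(F has_derivative F') (at x)"
  shows "dirD e F x = F' e"
proof -
  have "F differentiable at x" using assms by (auto simp: differentiable_def)
  then show ?thesis
    using frechet_derivative_at[OF assms] dirD_eq_frechet_derivative by metis
qed

lemma has_derivative_dirD:
  fixes F :: "'a::real_normed_vector \<Rightarrow> real"
  assumes "F differentiable at x"
  shows "(F has_derivative (\<lambda>e. dirD e F x)) (at x)"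
  unfolding dirD_eq_frechet_derivative[OF assms]
  using assms frechet_derivative_works by blast

lemma differentiable_cong_open:
  assumes "F differentiable at x" "open S" "x \<in> S" "\<And>y. y \<in> S \<Longrightarrow> F y = G y"
  shows "G differentiable at x"
proof -
  obtain F' where "(F has_derivative F') (at x)" using assms(1) by (auto simp: differentiable_def)
  then have "(G has_derivative F') (at x)" using assms(2-4) by (rule has_derivative_transform_within_open)
  then show ?thesis by (auto simp: differentiable_def)
qed

lemma frechet_derivative_cong_open:
  assumes "F differentiable at x" "open S" "x \<in> S" "\<And>y. y \<in> S \<Longrightarrow> F y = G y"
  shows "frechet_derivative F (at x) = frechet_derivative G (at x)"
  using assms by (rule frechet_derivative_transform_within_open)

lemma dirD_cong_open:
  fixes F :: "'a::real_normed_vector \<Rightarrow> real"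
  assumes "open S" "x \<in> S" "\<And>y. y \<in> S \<Longrightarrow> F y = G y"
  shows "dirD e F x = dirD e G x"
proof -
  have "((\<lambda>s. x + s *\<^sub>R e) \<longlongrightarrow> x + 0 *\<^sub>R e) (nhds 0)"
    by (intro tendsto_intros filterlim_ident)
  then have "((\<lambda>s. x + s *\<^sub>R e) \<longlongrightarrow> x) (nhds 0)"
    by simp
  then have "eventually (\<lambda>s. x + s *\<^sub>R e \<in> S) (nhds 0)"
    using assms(1,2) by (rule topological_tendstoD)
  then have "eventually (\<lambda>s. F (x + s *\<^sub>R e) = G (x + s *\<^sub>R e)) (nhds 0)"
    by eventually_elim (use assms(3) in auto)
  then show ?thesis unfolding dirD_def by (rule deriv_cong_ev) simp
qed

lemma Ck_on_cong:
  assumes "open S" "\<And>y. y \<in> S \<Longrightarrow> F y = G y" "Ck_on k S F"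
  shows "Ck_on k S G"
  using assms(2,3)
proof (induction k arbitrary: F G)
  case 0
  then have "continuous_on S F = continuous_on S G"
    by (intro continuous_on_cong) auto
  then show ?case using 0 by simp
next
  case (Suc k)
  have diff: "F differentiable at y" if "y \<in> S" for y
    using that Suc.prems(2) by simp
  have "Ck_on k S (\<lambda>x. frechet_derivative G (at x) e)" for e
  proof (rule Suc.IH)
    show "Ck_on k S (\<lambda>x. frechet_derivative F (at x) e)"
      using Suc.prems(2) by simp
    show "frechet_derivative F (at y) e = frechet_derivative G (at y) e" if "y \<in> S" for y
      by (rule fun_cong[OF frechet_derivative_cong_open[OF diff[OF that] assms(1) that Suc.prems(1)]])
  qed
  moreover have "G differentiable at y" if "y \<in> S" for y
    by (rule differentiable_cong_open[OF diff[OF that] assms(1) that Suc.prems(1)])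
  ultimately show ?case by simp
qed

lemma smooth_on_cong:
  assumes "open S" "\<And>y. y \<in> S \<Longrightarrow> F y = G y" "smooth_on S F"
  shows "smooth_on S G"
  using assms Ck_on_cong unfolding smooth_on_def by blast

lemma smooth_on_differentiable:
  assumes "smooth_on S F" "x \<in> S"
  shows "F differentiable at x"
  using assms Ck_on.simps(2)[of 0 S F] unfolding smooth_on_def by blast

lemma smooth_on_dirD:
  assumes "open S" "smooth_on S F"
  shows "smooth_on S (dirD e F)"
proof (rule smooth_on_cong[OF assms(1)])
  show "smooth_on S (\<lambda>x. frechet_derivative F (at x) e)"
    using assms(2) Ck_on.simps(2) unfolding smooth_on_def by blast
qed (use dirD_eq_frechet_derivative[OF smooth_on_differentiable[OF assms(2)]] in simp)

lemma Ck_on_compose_linear: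
  assumes "bounded_linear L" "open S" "L ` S \<subseteq> T" "Ck_on k T F"
  shows "Ck_on k S (\<lambda>x. F (L x))"
  using assms(4)
proof (induction k arbitrary: F)
  case 0
  then show ?case
    using assms(1,3) by (auto intro: continuous_on_compose2 linear_continuous_on)
next
  case (Suc k)
  have D: "((\<lambda>x. F (L x)) has_derivative (\<lambda>e. frechet_derivative F (at (L x)) (L e))) (at x)"
    if "x \<in> S" for x
  proof -
    have "F differentiable at (L x)"
      using Suc.prems that assms(3) by auto
    then have "(F has_derivative frechet_derivative F (at (L x))) (at (L x))"
      using frechet_derivative_works by blast
    then show ?thesis
      by (rule has_derivative_compose[OF bounded_linear_imp_has_derivative[OF assms(1)]])
  qed
  have "Ck_on k S (\<lambda>x. frechet_derivative (\<lambda>x. F (L x)) (at x) e)" for e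
  proof (rule Ck_on_cong[OF assms(2)])
    show "Ck_on k S (\<lambda>x. frechet_derivative F (at (L x)) (L e))"
      using Suc.prems by (intro Suc.IH) simp
    show "frechet_derivative F (at (L x)) (L e) = frechet_derivative (\<lambda>x. F (L x)) (at x) e"
      if "x \<in> S" for x
      by (rule fun_cong[OF frechet_derivative_at[OF D[OF that]]])
  qed
  then show ?case using D by (auto simp: differentiable_def)
qed

lemma smooth_on_compose_linear:
  assumes "bounded_linear L" "open S" "L ` S \<subseteq> T" "smooth_on T F"
  shows "smooth_on S (\<lambda>x. F (L x))"
  using assms Ck_on_compose_linear unfolding smooth_on_def by blast

lemma second_difference_eq_dirD:
  fixes F :: "'a::real_normed_vector \<Rightarrow> real"
  assumes "open S" "smooth_on S F" "h > 0"
    and S: "\<And>s t. 0 \<le> s \<Longrightarrow> s \<le> h \<Longrightarrow> 0 \<le> t \<Longrightarrow> t \<le> h \<Longrightarrow> x + s *\<^sub>R a + t *\<^sub>R b \<in> S"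
  obtains s t where "0 < s" "s < h" "0 < t" "t < h"
    "F (x + h *\<^sub>R a + h *\<^sub>R b) - F (x + h *\<^sub>R a) - F (x + h *\<^sub>R b) + F x
      = h * (h * dirD b (dirD a F) (x + s *\<^sub>R a + t *\<^sub>R b))"
proof -
  have diff: "F differentiable at y" "dirD a F differentiable at y" if "y \<in> S" for y
    using that assms(1,2) smooth_on_differentiable smooth_on_dirD by blast+
  let ?\<phi> = "\<lambda>s. F (x + h *\<^sub>R b + s *\<^sub>R a) - F (x + s *\<^sub>R a)"
  have "\<exists>s>0. s < h \<and> ?\<phi> h - ?\<phi> 0
      = (h - 0) * (dirD a F (x + h *\<^sub>R b + s *\<^sub>R a) - dirD a F (x + s *\<^sub>R a))"
  proof (rule MVT2)
    fix s assume "0 \<le> s" "s \<le> h"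
    then show "(?\<phi> has_real_derivative
        dirD a F (x + h *\<^sub>R b + s *\<^sub>R a) - dirD a F (x + s *\<^sub>R a)) (at s)"
      using S[of s h] S[of s 0] assms(3)
      by (intro DERIV_diff DERIV_dirD diff) (auto simp: algebra_simps)
  qed (use assms in auto)
  then obtain s where s: "0 < s" "s < h" "?\<phi> h - ?\<phi> 0
      = h * (dirD a F (x + h *\<^sub>R b + s *\<^sub>R a) - dirD a F (x + s *\<^sub>R a))"
    by auto
  let ?\<psi> = "\<lambda>t. dirD a F (x + s *\<^sub>R a + t *\<^sub>R b)"
  have "\<exists>t>0. t < h \<and> ?\<psi> h - ?\<psi> 0 = (h - 0) * dirD b (dirD a F) (x + s *\<^sub>R a + t *\<^sub>R b)"
    using s S by (intro MVT2 DERIV_dirD diff assms) auto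
  then obtain t where t: "0 < t" "t < h"
    "?\<psi> h - ?\<psi> 0 = h * dirD b (dirD a F) (x + s *\<^sub>R a + t *\<^sub>R b)"
    by auto
  show ?thesis
    using that[OF s(1,2) t(1,2)] s(3) t(3) by (simp add: algebra_simps)
qed

lemma dirD_commute:
  fixes F :: "'a::real_normed_vector \<Rightarrow> real"
  assumes "open S" "smooth_on S F" "x \<in> S"
  shows "dirD a (dirD b F) x = dirD b (dirD a F) x"
proof (rule ccontr)
  let ?P = "dirD a (dirD b F)" and ?Q = "dirD b (dirD a F)"
  assume "?P x \<noteq> ?Q x"
  then have pos: "\<bar>?P x - ?Q x\<bar> / 2 > 0" by simp
  have "isCont (dirD e (dirD e' F)) x" for e e'
    using smooth_on_dirD[OF assms(1) smooth_on_dirD[OF assms(1,2)]] assms(3)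
    by (blast intro: smooth_on_differentiable differentiable_imp_continuous_within)
  then have "isCont ?P x" "isCont ?Q x"
    by auto
  then have "eventually (\<lambda>y. dist (?P y) (?P x) < \<bar>?P x - ?Q x\<bar> / 2) (nhds x)"
    "eventually (\<lambda>y. dist (?Q y) (?Q x) < \<bar>?P x - ?Q x\<bar> / 2) (nhds x)"
    using pos unfolding isCont_def tendsto_at_iff_tendsto_nhds by (auto intro: tendstoD simp del: less_divide_eq_numeral1)
  moreover have "eventually (\<lambda>y. y \<in> S) (nhds x)"
    using assms by (simp add: eventually_nhds_in_open)
  ultimately have "eventually (\<lambda>y. y \<in> S \<and> dist (?P y) (?P x) < \<bar>?P x - ?Q x\<bar> / 2 \<and>
      dist (?Q y) (?Q x) < \<bar>?P x - ?Q x\<bar> / 2) (nhds x)"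
    by eventually_elim auto
  then obtain d where d: "d > 0" and near: "\<And>y. dist y x < d \<Longrightarrow> y \<in> S"
    "\<And>y. dist y x < d \<Longrightarrow> dist (?P y) (?P x) < \<bar>?P x - ?Q x\<bar> / 2"
    "\<And>y. dist y x < d \<Longrightarrow> dist (?Q y) (?Q x) < \<bar>?P x - ?Q x\<bar> / 2"
    unfolding eventually_nhds_metric by blast
  define h where "h = d / (norm a + norm b + 1)"
  have n: "norm a + norm b + 1 > 0" by (simp add: add_nonneg_pos)
  then have h: "h > 0" using d by (simp add: h_def)
  have small: "dist (x + s *\<^sub>R a + t *\<^sub>R b) x < d" if "0 \<le> s" "s \<le> h" "0 \<le> t" "t \<le> h" for s t
  proof -
    have "dist (x + s *\<^sub>R a + t *\<^sub>R b) x \<le> s * norm a + t * norm b"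
      using norm_triangle_ineq[of "s *\<^sub>R a" "t *\<^sub>R b"] that by (simp add: dist_norm)
    also have "\<dots> \<le> h * norm a + h * norm b"
      using that by (intro add_mono mult_right_mono) auto
    also have "\<dots> < h * (norm a + norm b + 1)" using h by (simp add: algebra_simps)
    also have "\<dots> = d" using n by (simp add: h_def)
    finally show ?thesis .
  qed
  obtain s t where st: "0 < s" "s < h" "0 < t" "t < h"
    "F (x + h *\<^sub>R a + h *\<^sub>R b) - F (x + h *\<^sub>R a) - F (x + h *\<^sub>R b) + F x
      = h * (h * ?Q (x + s *\<^sub>R a + t *\<^sub>R b))"
    by (rule second_difference_eq_dirD[OF assms(1,2) h near(1)[OF small]])
  have small': "dist (x + s *\<^sub>R b + t *\<^sub>R a) x < d" if "0 \<le> s" "s \<le> h" "0 \<le> t" "t \<le> h" for s t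
    using small[of t s] that by (simp add: algebra_simps)
  obtain s' t' where st': "0 < s'" "s' < h" "0 < t'" "t' < h"
    "F (x + h *\<^sub>R b + h *\<^sub>R a) - F (x + h *\<^sub>R b) - F (x + h *\<^sub>R a) + F x
      = h * (h * ?P (x + s' *\<^sub>R b + t' *\<^sub>R a))"
    by (rule second_difference_eq_dirD[OF assms(1,2) h near(1)[OF small']])
  have "h * (h * ?P (x + s' *\<^sub>R b + t' *\<^sub>R a)) = h * (h * ?Q (x + s *\<^sub>R a + t *\<^sub>R b))"
    unfolding st(5)[symmetric] st'(5)[symmetric] by (simp add: algebra_simps)
  then have eq: "?P (x + s' *\<^sub>R b + t' *\<^sub>R a) = ?Q (x + s *\<^sub>R a + t *\<^sub>R b)"
    using h by simp
  have "dist (?P (x + s' *\<^sub>R b + t' *\<^sub>R a)) (?P x) < \<bar>?P x - ?Q x\<bar> / 2"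
    "dist (?Q (x + s *\<^sub>R a + t *\<^sub>R b)) (?Q x) < \<bar>?P x - ?Q x\<bar> / 2"
    using st st' by (intro near small small'; simp)+
  then show False unfolding eq dist_real_def by argo
qed

lemma dirD_linear:
  fixes F :: "'a::real_normed_vector \<Rightarrow> real"
  assumes "F differentiable at x"
  shows "linear (\<lambda>e. dirD e F x)"
  using has_derivative_dirD[OF assms] has_derivative_linear by blast

lemma dirD_add:
  assumes "F differentiable at x" "G differentiable at x"
  shows "dirD e (\<lambda>y. F y + G y) x = dirD e F x + dirD e G x"
  by (rule dirD_eqI[OF has_derivative_add]) (intro has_derivative_dirD assms)+

lemma dirD_diff:
  assumes "F differentiable at x" "G differentiable at x"
  shows "dirD e (\<lambda>y. F y - G y) x = dirD e F x - dirD e G x"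
  by (rule dirD_eqI[OF has_derivative_diff]) (intro has_derivative_dirD assms)+

lemma dirD_mult:
  assumes "F differentiable at x" "G differentiable at x"
  shows "dirD e (\<lambda>y. F y * G y) x = F x * dirD e G x + dirD e F x * G x"
  by (rule dirD_eqI[OF has_derivative_mult]) (intro has_derivative_dirD assms)+

lemma dirD_cmult:
  assumes "F differentiable at x"
  shows "dirD e (\<lambda>y. c * F y) x = c * dirD e F x"
  by (rule dirD_eqI[OF has_derivative_mult_right]) (intro has_derivative_dirD assms)

lemma dirD_mult_const:
  assumes "F differentiable at x"
  shows "dirD e (\<lambda>y. F y * c) x = dirD e F x * c"
  by (rule dirD_eqI[OF has_derivative_mult_left]) (intro has_derivative_dirD assms)

lemma dirD_sum:
  assumes "\<And>i. i \<in> A \<Longrightarrow> F i differentiable at x"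
  shows "dirD e (\<lambda>y. \<Sum>i\<in>A. F i y) x = (\<Sum>i\<in>A. dirD e (F i) x)"
  by (rule dirD_eqI[OF has_derivative_sum]) (intro has_derivative_dirD assms)

lemma dirD_const [simp]: "dirD e (\<lambda>y. c) x = 0"
  by (simp add: dirD_def)

section \<open>Jet coordinates\<close>

abbreviation vdir :: "'n::finite \<Rightarrow> (real^'n) \<times> (real^'n) \<times> real" where
  "vdir c \<equiv> (axis c 1, 0, 0)"

abbreviation qdir :: "'n::finite \<Rightarrow> (real^'n) \<times> (real^'n) \<times> real" where
  "qdir c \<equiv> (0, axis c 1, 0)"

abbreviation tdir :: "(real^'n::finite) \<times> (real^'n) \<times> real" where
  "tdir \<equiv> (0, 0, 1)"

lemma partial_v_eq_dirD:
  "partial c (\<lambda>v'. F v' q t) v = dirD (vdir c) (\<lambda>(v, q, t). F v q t) (v, q, t)"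
  by (simp add: partial_def dirD_def)

lemma partial_q_eq_dirD:
  "partial c (\<lambda>q'. F v q' t) q = dirD (qdir c) (\<lambda>(v, q, t). F v q t) (v, q, t)"
  by (simp add: partial_def dirD_def)

lemma partial_eq_dirD:
  "partial c (\<lambda>v'. X (v', q, t)) v = dirD (vdir c) X (v, q, t)"
  "partial c (\<lambda>q'. X (v, q', t)) q = dirD (qdir c) X (v, q, t)"
  by (simp_all add: partial_def dirD_def)

lemma deriv_t_eq_dirD:
  "deriv (\<lambda>t'. F v q t') t = dirD tdir (\<lambda>(v, q, t). F v q t) (v, q, t)"
  using DERIV_shift[of "F v q" _ 0 t]
  by (simp add: dirD_def deriv_def add.commute)

text \<open>The part \<open>\<partial>/\<partial>t + v\<^sup>c \<partial>/\<partial>q\<^sup>c\<close> of the total derivative.\<close>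

definition dt_first ::
  "((real^'n::finite) \<times> (real^'n) \<times> real \<Rightarrow> real) \<Rightarrow> (real^'n) \<times> (real^'n) \<times> real \<Rightarrow> real" where
  "dt_first H p = dirD tdir H p + (\<Sum>c\<in>UNIV. fst p $ c * dirD (qdir c) H p)"

lemma dt_first_cong_open:
  assumes "open S" "p \<in> S" "\<And>y. y \<in> S \<Longrightarrow> F y = G y"
  shows "dt_first F p = dt_first G p"
proof -
  have "dirD e F p = dirD e G p" for e
    using assms by (rule dirD_cong_open)
  then show ?thesis by (simp add: dt_first_def)
qed

lemma dt_first_const [simp]: "dt_first (\<lambda>y. c) p = 0"
  by (simp add: dt_first_def)

lemma dt_first_diff:
  assumes "F differentiable at p" "G differentiable at p"
  shows "dt_first (\<lambda>y. F y - G y) p = dt_first F p - dt_first G p"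
  using assms by (simp add: dt_first_def dirD_diff sum_subtractf algebra_simps)

lemma dt_first_cmult:
  assumes "F differentiable at p"
  shows "dt_first (\<lambda>y. k * F y) p = k * dt_first F p"
  using assms by (simp add: dt_first_def dirD_cmult sum_distrib_left algebra_simps)

lemma has_derivative_fst_component:
  "((\<lambda>y. fst y $ c) has_derivative (\<lambda>e. fst e $ c)) (at p)"
  by (intro bounded_linear_imp_has_derivative bounded_linear_compose[OF bounded_linear_vec_nth bounded_linear_fst])

lemma differentiable_fst_component: "(\<lambda>y. fst y $ c) differentiable at p"
  using has_derivative_fst_component by (rule differentiableI)

lemma differentiable_dt_first:
  assumes "open S" "smooth_on S H" "p \<in> S"
  shows "dt_first H differentiable at p"
proof -
  have diff: "dirD e H differentiable at p" for e
    using assms smooth_on_dirD smooth_on_differentiable by blast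
  show ?thesis
    unfolding dt_first_def
    by (intro differentiable_add differentiable_sum differentiable_mult
        differentiable_fst_component diff finite ballI)
qed

lemma dirD_dt_first:
  assumes "open S" "smooth_on S H" "p \<in> S"
  shows "dirD e (dt_first H) p = dt_first (dirD e H) p + (\<Sum>c\<in>UNIV. fst e $ c * dirD (qdir c) H p)"
proof -
  have diff: "dirD d H differentiable at p" for d
    using assms smooth_on_dirD smooth_on_differentiable by blast
  have comp: "dirD e (\<lambda>y. fst y $ c) p = fst e $ c" for c
    by (rule dirD_eqI[OF has_derivative_fst_component])
  have prod: "(\<lambda>y. fst y $ c * dirD (qdir c) H y) differentiable at p" for c
    by (intro differentiable_mult differentiable_fst_component diff)
  have "dirD e (dt_first H) p = dirD e (dirD tdir H) p +
      (\<Sum>c\<in>UNIV. fst p $ c * dirD e (dirD (qdir c) H) p + fst e $ c * dirD (qdir c) H p)"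
    unfolding dt_first_def
    by (simp add: dirD_add dirD_sum dirD_mult diff prod differentiable_sum comp
        differentiable_fst_component)
  then show ?thesis
    by (simp add: dt_first_def sum.distrib dirD_commute[OF assms, of e])
qed

lemma sum_axis_mult: "(\<Sum>d\<in>UNIV. axis c (1::real) $ d * F d) = F c"
  "(\<Sum>d\<in>UNIV. F d * axis c (1::real) $ d) = F c"
  by (simp_all add: axis_def if_distrib if_distribR cong: if_cong)

lemma dirD_vdir_dt_first:
  assumes "open S" "smooth_on S H" "p \<in> S"
  shows "dirD (vdir c) (dt_first H) p = dt_first (dirD (vdir c) H) p + dirD (qdir c) H p"
  by (simp add: dirD_dt_first[OF assms] sum_axis_mult)

lemma dirD_qdir_dt_first:
  assumes "open S" "smooth_on S H" "p \<in> S"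
  shows "dirD (qdir c) (dt_first H) p = dt_first (dirD (qdir c) H) p"
  by (simp add: dirD_dt_first[OF assms])

lemma dirD_affine:
  assumes "open S" "p \<in> S" "\<And>y. y \<in> S \<Longrightarrow> F y = (\<Sum>c\<in>UNIV. X c y * w $ c) + Y y"
    and "\<And>c. X c differentiable at p" "Y differentiable at p"
  shows "dirD e F p = (\<Sum>c\<in>UNIV. dirD e (X c) p * w $ c) + dirD e Y p"
proof -
  have prod: "(\<lambda>y. X c y * w $ c) differentiable at p" for c
    by (intro differentiable_mult assms) simp
  have "dirD e F p = dirD e (\<lambda>y. (\<Sum>c\<in>UNIV. X c y * w $ c) + Y y) p"
    by (rule dirD_cong_open[OF assms(1-3)])
  then show ?thesis
    using assms(4,5) prod by (simp add: dirD_add dirD_sum dirD_mult_const differentiable_sum)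
qed

lemma partial_linear:
  "partial a (\<lambda>w::real^'n::finite. (\<Sum>c\<in>UNIV. X c * w $ c) + Y) w = X a"
proof -
  have "((\<lambda>s. (\<Sum>c\<in>UNIV. X c * (w + s *\<^sub>R axis a 1) $ c) + Y) has_real_derivative
      (\<Sum>c\<in>UNIV. X c * axis a 1 $ c)) (at 0)"
    by (auto intro!: derivative_eq_intros simp: mult.commute)
  then show ?thesis
    by (simp add: partial_def DERIV_imp_deriv sum_axis_mult)
qed

lemma total_deriv_affine:
  fixes X :: "'n::finite \<Rightarrow> (real^'n) \<times> (real^'n) \<times> real \<Rightarrow> real"
  assumes "open S" "(v, q, t) \<in> S"
    and F: "\<And>w v q t. (v, q, t) \<in> S \<Longrightarrow> F w v q t = (\<Sum>c\<in>UNIV. X c (v, q, t) * w $ c) + Y (v, q, t)"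
    and diff: "\<And>c. X c differentiable at (v, q, t)" "Y differentiable at (v, q, t)"
  shows "total_deriv F z w v q t =
    (\<Sum>c\<in>UNIV. dt_first (X c) (v, q, t) * w $ c) + dt_first Y (v, q, t)
    + (\<Sum>d\<in>UNIV. w $ d * ((\<Sum>c\<in>UNIV. dirD (vdir d) (X c) (v, q, t) * w $ c) + dirD (vdir d) Y (v, q, t)))
    + (\<Sum>c\<in>UNIV. z $ c * X c (v, q, t))"
proof -
  have *: "dirD e (\<lambda>(v, q, t). F w v q t) (v, q, t)
      = (\<Sum>c\<in>UNIV. dirD e (X c) (v, q, t) * w $ c) + dirD e Y (v, q, t)" for e
    by (rule dirD_affine[OF assms(1,2)]) (use F diff in auto)
  have w: "partial c (\<lambda>w'. F w' v q t) w = X c (v, q, t)" for c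
    using F[OF assms(2)] by (simp add: partial_linear)
  have "(\<Sum>c\<in>UNIV. dt_first (X c) (v, q, t) * w $ c) =
      (\<Sum>c\<in>UNIV. dirD tdir (X c) (v, q, t) * w $ c)
      + (\<Sum>d\<in>UNIV. v $ d * (\<Sum>c\<in>UNIV. dirD (qdir d) (X c) (v, q, t) * w $ c))"
    unfolding dt_first_def sum_distrib_left
    by (subst sum.swap) (simp add: algebra_simps sum.distrib sum_distrib_left sum_distrib_right)
  moreover have "(\<Sum>d\<in>UNIV. v $ d * ((\<Sum>c\<in>UNIV. dirD (qdir d) (X c) (v, q, t) * w $ c) + dirD (qdir d) Y (v, q, t)))
     = (\<Sum>d\<in>UNIV. v $ d * (\<Sum>c\<in>UNIV. dirD (qdir d) (X c) (v, q, t) * w $ c))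
      + (\<Sum>d\<in>UNIV. v $ d * dirD (qdir d) Y (v, q, t))"
    by (simp add: distrib_left sum.distrib)
  ultimately show ?thesis
    unfolding total_deriv_def partial_q_eq_dirD partial_v_eq_dirD[where F = "F w"] deriv_t_eq_dirD * w
    by (simp add: dt_first_def[of Y])
qed

section \<open>Forces affine in the second derivatives\<close>

locale affine_force =
  fixes U :: "(real^'n::finite) set" and I :: "real set"
    and f :: "'n \<Rightarrow> real^'n \<Rightarrow> real^'n \<Rightarrow> real^'n \<Rightarrow> real \<Rightarrow> real"
    and G :: "'n \<Rightarrow> 'n \<Rightarrow> (real^'n) \<times> (real^'n) \<times> real \<Rightarrow> real"
    and H :: "'n \<Rightarrow> (real^'n) \<times> (real^'n) \<times> real \<Rightarrow> real"
    and S :: "((real^'n) \<times> (real^'n) \<times> real) set"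
  defines "S \<equiv> UNIV \<times> U \<times> I"
  assumes open_U: "open U" and open_I: "open I"
    and smooth_G: "\<And>a b. smooth_on S (G a b)" and smooth_H: "\<And>a. smooth_on S (H a)"
    and f_eq: "\<And>a w v q t. (v, q, t) \<in> S \<Longrightarrow> f a w v q t = (\<Sum>b\<in>UNIV. G a b (v, q, t) * w $ b) + H a (v, q, t)"
    and G_sym: "\<And>a b p. p \<in> S \<Longrightarrow> G a b p = G b a p"
begin

text \<open>
  For \<open>f\<^sub>a = G\<^sub>a\<^sub>b w\<^sup>b + H\<^sub>a\<close>, the function \<open>r\<^sub>a\<^sub>b\<close> contains half the total derivative of
  \<open>K\<^sub>a\<^sub>b\<^sub>c w\<^sup>c + L\<^sub>a\<^sub>b\<close>; \<open>R\<^sub>a\<^sub>b\<close> and \<open>Q\<^sub>a\<^sub>b\<close> are the values of \<open>r\<^sub>a\<^sub>b\<close> and \<open>s\<^sub>a\<^sub>b\<close> at \<open>w = z = 0\<close>.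
\<close>

definition K :: "'n \<Rightarrow> 'n \<Rightarrow> 'n \<Rightarrow> (real^'n) \<times> (real^'n) \<times> real \<Rightarrow> real" where
  "K a b c p = dirD (vdir a) (G b c) p - dirD (vdir b) (G a c) p"

definition L :: "'n \<Rightarrow> 'n \<Rightarrow> (real^'n) \<times> (real^'n) \<times> real \<Rightarrow> real" where
  "L a b p = dirD (vdir a) (H b) p - dirD (vdir b) (H a) p"

definition R :: "'n \<Rightarrow> 'n \<Rightarrow> (real^'n) \<times> (real^'n) \<times> real \<Rightarrow> real" where
  "R a b p = dirD (qdir b) (H a) p - dirD (qdir a) (H b) p
     + 1 / 2 * (dt_first (dirD (vdir a) (H b)) p - dt_first (dirD (vdir b) (H a)) p)"

definition Q :: "'n \<Rightarrow> 'n \<Rightarrow> (real^'n) \<times> (real^'n) \<times> real \<Rightarrow> real" where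
  "Q a b p = 1 / 2 * (dirD (vdir b) (H a) p + dirD (vdir a) (H b) p) - dt_first (G b a) p"

lemma open_S: "open S"
  unfolding S_def using open_U open_I by (intro open_Times open_UNIV)

lemma mem_S: "(v, q, t) \<in> S \<longleftrightarrow> q \<in> U \<and> t \<in> I"
  by (simp add: S_def)

lemmas smooth_dirD_G = smooth_on_dirD[OF open_S smooth_G]
  and smooth_dirD_H = smooth_on_dirD[OF open_S smooth_H]

lemmas smooth = smooth_G smooth_H smooth_dirD_G smooth_dirD_H
  smooth_on_dirD[OF open_S smooth_dirD_G] smooth_on_dirD[OF open_S smooth_dirD_H]

lemmas diff = smooth[THEN smooth_on_differentiable]
  and diff_dt = smooth[THEN differentiable_dt_first[OF open_S]]

lemma diff_K: "p \<in> S \<Longrightarrow> K a b c differentiable at p"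
  unfolding K_def by (intro differentiable_diff diff)

lemma diff_L: "p \<in> S \<Longrightarrow> L a b differentiable at p"
  unfolding L_def by (intro differentiable_diff diff)

lemma dirD_L: "p \<in> S \<Longrightarrow> dirD e (L a b) p = dirD e (dirD (vdir a) (H b)) p - dirD e (dirD (vdir b) (H a)) p"
  unfolding L_def by (intro dirD_diff diff)

lemma dt_first_L: "p \<in> S \<Longrightarrow> dt_first (L a b) p = dt_first (dirD (vdir a) (H b)) p - dt_first (dirD (vdir b) (H a)) p"
  unfolding L_def by (intro dt_first_diff diff)

lemma partial_v_f:
  assumes "(v, q, t) \<in> S"
  shows "partial b (\<lambda>v'. f a w v' q t) v =
    (\<Sum>c\<in>UNIV. dirD (vdir b) (G a c) (v, q, t) * w $ c) + dirD (vdir b) (H a) (v, q, t)"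
  unfolding partial_v_eq_dirD
  by (rule dirD_affine[OF open_S assms]) (auto simp: f_eq intro: diff[OF assms])

lemma partial_q_f:
  assumes "(v, q, t) \<in> S"
  shows "partial b (\<lambda>q'. f a w v q' t) q =
    (\<Sum>c\<in>UNIV. dirD (qdir b) (G a c) (v, q, t) * w $ c) + dirD (qdir b) (H a) (v, q, t)"
  unfolding partial_q_eq_dirD
  by (rule dirD_affine[OF open_S assms]) (auto simp: f_eq intro: diff[OF assms])

lemma partial_w_f:
  assumes "(v, q, t) \<in> S"
  shows "partial a (\<lambda>w'. f b w' v q t) w = G b a (v, q, t)"
  unfolding f_eq[OF assms] by (rule partial_linear)

lemma r_fun_eq:
  assumes p: "(v, q, t) \<in> S"
  shows "r_fun f a b z w v q t =
    (\<Sum>c\<in>UNIV. dirD (qdir b) (G a c) (v, q, t) * w $ c) + dirD (qdir b) (H a) (v, q, t)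
    - ((\<Sum>c\<in>UNIV. dirD (qdir a) (G b c) (v, q, t) * w $ c) + dirD (qdir a) (H b) (v, q, t))
    + 1 / 2 * ((\<Sum>c\<in>UNIV. dt_first (K a b c) (v, q, t) * w $ c) + dt_first (L a b) (v, q, t)
    + (\<Sum>d\<in>UNIV. w $ d * ((\<Sum>c\<in>UNIV. dirD (vdir d) (K a b c) (v, q, t) * w $ c)
        + dirD (vdir d) (L a b) (v, q, t)))
    + (\<Sum>c\<in>UNIV. z $ c * K a b c (v, q, t)))"
proof -
  have "total_deriv (\<lambda>w v q t. partial a (\<lambda>v'. f b w v' q t) v - partial b (\<lambda>v'. f a w v' q t) v) z w v q t
    = (\<Sum>c\<in>UNIV. dt_first (K a b c) (v, q, t) * w $ c) + dt_first (L a b) (v, q, t)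
    + (\<Sum>d\<in>UNIV. w $ d * ((\<Sum>c\<in>UNIV. dirD (vdir d) (K a b c) (v, q, t) * w $ c)
        + dirD (vdir d) (L a b) (v, q, t)))
    + (\<Sum>c\<in>UNIV. z $ c * K a b c (v, q, t))"
    by (rule total_deriv_affine[OF open_S p])
       (auto simp: partial_v_f K_def L_def sum_subtractf left_diff_distrib intro: diff_K[OF p] diff_L[OF p])
  then show ?thesis
    unfolding r_fun_def partial_q_f[OF p] by simp
qed

lemma s_fun_eq:
  assumes p: "(v, q, t) \<in> S"
  shows "s_fun f a b z w v q t =
    (\<Sum>c\<in>UNIV. (1 / 2 * (dirD (vdir b) (G a c) (v, q, t) + dirD (vdir a) (G b c) (v, q, t))
        - dirD (vdir c) (G b a) (v, q, t)) * w $ c) + Q a b (v, q, t)"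
proof -
  have "total_deriv (\<lambda>w v q t. partial a (\<lambda>w'. f b w' v q t) w) z w v q t
    = (\<Sum>c\<in>UNIV. dt_first (\<lambda>y. 0) (v, q, t) * w $ c) + dt_first (G b a) (v, q, t)
    + (\<Sum>d\<in>UNIV. w $ d * ((\<Sum>c\<in>UNIV. dirD (vdir d) (\<lambda>y. 0) (v, q, t) * w $ c)
        + dirD (vdir d) (G b a) (v, q, t)))
    + (\<Sum>c\<in>UNIV. z $ c * 0)"
    by (rule total_deriv_affine[OF open_S p]) (auto simp: partial_w_f intro: diff[OF p])
  then have T: "total_deriv (\<lambda>w v q t. partial a (\<lambda>w'. f b w' v q t) w) z w v q t
    = dt_first (G b a) (v, q, t) + (\<Sum>d\<in>UNIV. w $ d * dirD (vdir d) (G b a) (v, q, t))"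
    by simp
  show ?thesis
    unfolding s_fun_def partial_v_f[OF p] T Q_def
    by (simp add: sum.distrib sum_subtractf sum_distrib_left algebra_simps sum_divide_distrib add_divide_distrib)
qed

lemma r_first_order_imp_K:
  assumes "first_order U I (r_fun f a b)" "p \<in> S"
  shows "K a b c p = 0"
proof -
  obtain v q t where p: "p = (v, q, t)" by (cases p)
  have "r_fun f a b (axis c 1) 0 v q t = r_fun f a b 0 0 v q t"
    using assms unfolding first_order_def p mem_S by blast
  then show ?thesis
    using assms(2) unfolding p by (simp add: r_fun_eq sum_axis_mult)
qed

lemma K_zero_derivs:
  assumes "\<And>p. p \<in> S \<Longrightarrow> K a b c p = 0" "p \<in> S"
  shows "dirD e (K a b c) p = 0" "dt_first (K a b c) p = 0"
proof -
  show "dirD e (K a b c) p = 0"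
    using dirD_cong_open[OF open_S assms(2), of "K a b c" "\<lambda>y. 0"] assms(1) by simp
  show "dt_first (K a b c) p = 0"
    using dt_first_cong_open[OF open_S assms(2), of "K a b c" "\<lambda>y. 0"] assms(1) by simp
qed

lemma r_fun_eq_of_K_zero:
  assumes K: "\<And>a b c p. p \<in> S \<Longrightarrow> K a b c p = 0" and p: "(v, q, t) \<in> S"
  shows "r_fun f a b z w v q t = R a b (v, q, t) +
    (\<Sum>c\<in>UNIV. (dirD (qdir b) (G a c) (v, q, t) - dirD (qdir a) (G b c) (v, q, t)
       + 1 / 2 * dirD (vdir c) (L a b) (v, q, t)) * w $ c)"
  unfolding r_fun_eq[OF p] R_def dt_first_L[OF p, symmetric]
  using K[OF p] K_zero_derivs[OF K p]
  by (simp add: sum.distrib sum_subtractf sum_distrib_left algebra_simps sum_divide_distrib)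

lemma h_condition_iff:
  assumes p: "p \<in> S"
  shows "dirD (qdir b) (G a c) p - dirD (qdir a) (G b c) p + 1 / 2 * dirD (vdir c) (L a b) p = 0
    \<longleftrightarrow> dirD (vdir b) (dirD (vdir c) (H a)) p - dirD (vdir a) (dirD (vdir c) (H b)) p
      = 2 * (dirD (qdir b) (G a c) p - dirD (qdir a) (G b c) p)"
  unfolding dirD_L[OF p] dirD_commute[OF open_S smooth_H p, of _ "vdir c"]
  by (auto simp: field_simps)

lemma s_fun_eq_of_K_zero:
  assumes K: "\<And>a b c p. p \<in> S \<Longrightarrow> K a b c p = 0" and p: "(v, q, t) \<in> S"
  shows "s_fun f a b z w v q t = Q a b (v, q, t)"
proof -
  have sym: "dirD e (G a b) (v, q, t) = dirD e (G b a) (v, q, t)" for e a b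
    by (rule dirD_cong_open[OF open_S p]) (rule G_sym)
  have K': "dirD (vdir a) (G b c) (v, q, t) = dirD (vdir b) (G a c) (v, q, t)" for a b c
    using K[OF p, of a b c] by (simp add: K_def)
  have "dirD (vdir c) (G b a) (v, q, t) = dirD (vdir b) (G a c) (v, q, t)" for c
    using K'[of c b a] sym[of _ a c] by simp
  then show ?thesis
    unfolding s_fun_eq[OF p] K'[of a b] by simp
qed

lemma dirD_R:
  assumes p: "p \<in> S"
  shows "dirD (vdir c) (R a b) p =
    dirD (qdir b) (dirD (vdir c) (H a)) p - dirD (qdir a) (dirD (vdir c) (H b)) p
    + 1 / 2 * (dirD (qdir c) (dirD (vdir a) (H b)) p - dirD (qdir c) (dirD (vdir b) (H a)) p
      + dt_first (dirD (vdir c) (dirD (vdir a) (H b))) p - dt_first (dirD (vdir c) (dirD (vdir b) (H a))) p)"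
proof -
  have "dirD (vdir c) (R a b) p =
    dirD (vdir c) (dirD (qdir b) (H a)) p - dirD (vdir c) (dirD (qdir a) (H b)) p
    + 1 / 2 * (dirD (vdir c) (dt_first (dirD (vdir a) (H b))) p
      - dirD (vdir c) (dt_first (dirD (vdir b) (H a))) p)"
    unfolding R_def
    by (subst dirD_add dirD_cmult dirD_diff;
        (intro differentiable_add differentiable_diff differentiable_mult differentiable_const
          diff diff_dt p)?)+
      (rule refl)
  then show ?thesis
    by (simp add: dirD_vdir_dt_first[OF open_S smooth_dirD_H p]
        dirD_commute[OF open_S smooth_H p, of "vdir c" "qdir _"] algebra_simps)
qed

lemma dirD_Q:
  assumes p: "p \<in> S"
  shows "dirD (qdir c) (Q a b) p =
    1 / 2 * (dirD (qdir c) (dirD (vdir b) (H a)) p + dirD (qdir c) (dirD (vdir a) (H b)) p)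
    - dt_first (dirD (qdir c) (G b a)) p"
proof -
  have "dirD (qdir c) (Q a b) p =
    1 / 2 * (dirD (qdir c) (dirD (vdir b) (H a)) p + dirD (qdir c) (dirD (vdir a) (H b)) p)
    - dirD (qdir c) (dt_first (G b a)) p"
    unfolding Q_def
    by (subst dirD_add dirD_cmult dirD_diff;
        (intro differentiable_add differentiable_diff differentiable_mult differentiable_const
          diff diff_dt p)?)+
      (rule refl)
  then show ?thesis
    by (simp add: dirD_qdir_dt_first[OF open_S smooth_G p])
qed

definition "first_condition \<longleftrightarrow>
  (\<forall>a b c. \<forall>p\<in>S. dirD (vdir c) (G a b) p - dirD (vdir b) (G a c) p = 0)"

definition "second_condition \<longleftrightarrow>
  (\<forall>a b c. \<forall>p\<in>S. dirD (vdir b) (dirD (vdir c) (H a)) p - dirD (vdir a) (dirD (vdir c) (H b)) p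
      = 2 * (dirD (qdir b) (G a c) p - dirD (qdir a) (G b c) p))"

definition "third_condition \<longleftrightarrow>
  (\<forall>a b c. \<forall>p\<in>S. cyclic_sum (\<lambda>a b c. dirD (qdir b) (dirD (vdir c) (H a)) p
      - dirD (qdir c) (dirD (vdir b) (H a)) p) a b c = 0)"

lemma first_condition_iff: "first_condition \<longleftrightarrow> (\<forall>a b c. \<forall>p\<in>S. K a b c p = 0)"
proof -
  have "dirD e (G a b) p = dirD e (G b a) p" if "p \<in> S" for e a b p
    by (rule dirD_cong_open[OF open_S that]) (rule G_sym)
  then have "K a b c p = dirD (vdir a) (G c b) p - dirD (vdir b) (G c a) p" if "p \<in> S" for a b c p
    using that by (simp add: K_def)
  then show ?thesis
    unfolding first_condition_def by auto
qed

lemma dt_first_second_condition: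
  assumes second_condition "p \<in> S"
  shows "dt_first (dirD (vdir c) (dirD (vdir b) (H a))) p - dt_first (dirD (vdir c) (dirD (vdir a) (H b))) p
    = 2 * (dt_first (dirD (qdir b) (G c a)) p - dt_first (dirD (qdir a) (G c b)) p)"
proof -
  have "dirD (vdir c) (dirD (vdir b) (H a)) y - dirD (vdir c) (dirD (vdir a) (H b)) y
      = 2 * (dirD (qdir b) (G c a) y - dirD (qdir a) (G c b) y)" if y: "y \<in> S" for y
  proof -
    have "dirD e (G a b) y = dirD e (G b a) y" for e a b
      by (rule dirD_cong_open[OF open_S y]) (rule G_sym)
    then show ?thesis
      using assms(1) y unfolding second_condition_def
      by (simp add: dirD_commute[OF open_S smooth_H y, of "vdir c"])
  qed
  then have "dt_first (\<lambda>y. dirD (vdir c) (dirD (vdir b) (H a)) y - dirD (vdir c) (dirD (vdir a) (H b)) y) p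
      = dt_first (\<lambda>y. 2 * (dirD (qdir b) (G c a) y - dirD (qdir a) (G c b) y)) p"
    by (rule dt_first_cong_open[OF open_S assms(2)])
  then show ?thesis
    using assms(2) by (simp add: dt_first_diff dt_first_cmult diff differentiable_diff)
qed

lemma cross_condition_iff:
  assumes "first_condition" "second_condition" and p: "(v, q, t) \<in> S"
  shows "partial c (\<lambda>v'. r_fun f a b z w v' q t) v =
        partial b (\<lambda>q'. s_fun f a c z w v q' t) q - partial a (\<lambda>q'. s_fun f b c z w v q' t) q
    \<longleftrightarrow> cyclic_sum (\<lambda>a b c. dirD (qdir b) (dirD (vdir c) (H a)) (v, q, t)
      - dirD (qdir c) (dirD (vdir b) (H a)) (v, q, t)) a b c = 0"
proof -
  have K: "K a b c y = 0" if "y \<in> S" for a b c y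
    using assms(1) that first_condition_iff by blast
  have "r_fun f a b z w v q t = R a b (v, q, t)" if "(v, q, t) \<in> S" for a b v q t
    using r_fun_eq_of_K_zero[OF K that] h_condition_iff[OF that] assms(2) that
    unfolding second_condition_def by simp
  then have "dirD (vdir c) (\<lambda>(v, q, t). r_fun f a b z w v q t) (v, q, t) = dirD (vdir c) (R a b) (v, q, t)"
    by (intro dirD_cong_open[OF open_S p]) auto
  moreover have "dirD e (\<lambda>(v, q, t). s_fun f a c z w v q t) (v, q, t) = dirD e (Q a c) (v, q, t)" for a e
    by (intro dirD_cong_open[OF open_S p]) (auto simp: s_fun_eq_of_K_zero[OF K])
  ultimately show ?thesis
    unfolding partial_v_eq_dirD partial_q_eq_dirD
    using dt_first_second_condition[OF assms(2) p, of c b a]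
    by (simp add: dirD_R[OF p] dirD_Q[OF p] cyclic_sum_def algebra_simps) argo
qed

theorem condition_A_iff:
  "condition_A U I f \<longleftrightarrow> first_condition \<and> second_condition \<and> third_condition"
proof
  assume A: "condition_A U I f"
  have K: "K a b c p = 0" if "p \<in> S" for a b c p
    using A that r_first_order_imp_K unfolding condition_A_def by blast
  have 1: first_condition
    using K first_condition_iff by blast
  have 2: second_condition
    unfolding second_condition_def
  proof (intro allI ballI)
    fix a b c p assume p: "p \<in> S"
    obtain v q t where p_eq: "p = (v, q, t)" by (cases p)
    have "first_order U I (r_fun f a b)"
      using A unfolding condition_A_def by blast
    then have "r_fun f a b 0 (axis c 1) v q t = r_fun f a b 0 0 v q t"
      using p unfolding first_order_def p_eq mem_S by blast
    then show "dirD (vdir b) (dirD (vdir c) (H a)) p - dirD (vdir a) (dirD (vdir c) (H b)) p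
      = 2 * (dirD (qdir b) (G a c) p - dirD (qdir a) (G b c) p)"
      using p unfolding h_condition_iff[OF p, symmetric] unfolding p_eq
      by (simp add: r_fun_eq_of_K_zero[OF K] sum_axis_mult)
  qed
  have third_condition
    unfolding third_condition_def
  proof (intro allI ballI)
    fix a b c p assume p: "p \<in> S"
    obtain v q t where p_eq: "p = (v, q, t)" by (cases p)
    show "cyclic_sum (\<lambda>a b c. dirD (qdir b) (dirD (vdir c) (H a)) p
      - dirD (qdir c) (dirD (vdir b) (H a)) p) a b c = 0"
      using A p unfolding p_eq cross_condition_iff[OF 1 2 p[unfolded p_eq], of c a b 0 0, symmetric]
      by (simp add: condition_A_def mem_S)
  qed
  with 1 2 show "first_condition \<and> second_condition \<and> third_condition" by blast
next
  assume B: "first_condition \<and> second_condition \<and> third_condition"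
  then have K: "K a b c y = 0" if "y \<in> S" for a b c y
    using that first_condition_iff by blast
  have r: "r_fun f a b z w v q t = R a b (v, q, t)" if "(v, q, t) \<in> S" for a b z w v q t
    using r_fun_eq_of_K_zero[OF K that] h_condition_iff[OF that] B that
    unfolding second_condition_def by simp
  show "condition_A U I f"
    unfolding condition_A_def
  proof (intro conjI allI ballI)
    fix a b
    show "first_order U I (r_fun f a b)" "first_order U I (s_fun f a b)"
      unfolding first_order_def by (auto simp: r s_fun_eq_of_K_zero[OF K] mem_S)
  next
    fix a b w v q t assume "q \<in> U" "t \<in> I"
    then show "partial b (\<lambda>w'. f a w' v q t) w = partial a (\<lambda>w'. f b w' v q t) w"
      by (simp add: partial_w_f mem_S G_sym[of _ a b])
  next
    fix a b c z w v q t assume "q \<in> U" "t \<in> I"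
    then have p: "(v, q, t) \<in> S" by (simp add: mem_S)
    show "partial c (\<lambda>v'. r_fun f a b z w v' q t) v =
        partial b (\<lambda>q'. s_fun f a c z w v q' t) q - partial a (\<lambda>q'. s_fun f b c z w v q' t) q"
      unfolding cross_condition_iff[OF B[THEN conjunct1] B[THEN conjunct2, THEN conjunct1] p]
      using B p unfolding third_condition_def by blast
  qed
qed

end

section \<open>The equivalence\<close>

lemma constant_of_partial_zero:
  fixes \<phi> :: "real^'n::finite \<Rightarrow> real"
  assumes diff: "\<And>w. \<phi> differentiable at w" and zero: "\<And>c w. partial c \<phi> w = 0"
  shows "\<phi> w = \<phi> w'"
proof (rule has_derivative_zero_unique[where f = \<phi> and s = UNIV])
  fix x
  have lin: "linear (\<lambda>e. dirD e \<phi> x)" by (rule dirD_linear[OF diff])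
  have "dirD e \<phi> x = 0" for e
  proof -
    have "dirD e \<phi> x = dirD (\<Sum>c\<in>UNIV. e $ c *\<^sub>R axis c 1) \<phi> x"
      using basis_expansion[of e] by (simp add: scalar_mult_eq_scaleR)
    also have "\<dots> = (\<Sum>c\<in>UNIV. e $ c * dirD (axis c 1) \<phi> x)"
      by (simp add: linear_sum[OF lin] linear_scale[OF lin])
    finally show ?thesis
      using zero by (simp add: dirD_def partial_def)
  qed
  then show "(\<phi> has_derivative (\<lambda>h. 0)) (at x)"
    using has_derivative_dirD[OF diff, of x] by simp
qed auto

lemma affine_of_second_partials_zero:
  fixes \<phi> :: "real^'n::finite \<Rightarrow> real"
  assumes diff: "\<And>w. \<phi> differentiable at w" "\<And>c w. partial c \<phi> differentiable at w"
    and zero: "\<And>c d w. partial d (partial c \<phi>) w = 0"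
  shows "\<phi> w = (\<Sum>c\<in>UNIV. partial c \<phi> 0 * w $ c) + \<phi> 0"
proof -
  let ?\<psi> = "\<lambda>w. \<phi> w - (\<Sum>c\<in>UNIV. partial c \<phi> 0 * w $ c)"
  have lin: "(\<lambda>w. \<Sum>c\<in>UNIV. partial c \<phi> 0 * w $ c) differentiable at w" for w
    by (intro differentiable_sum differentiable_mult differentiable_const finite ballI
        bounded_linear_imp_differentiable[OF bounded_linear_vec_nth])
  have "partial c ?\<psi> w = partial c \<phi> w - partial c \<phi> 0" for c w
    using dirD_diff[OF diff(1) lin, where e = "axis c 1" and x = w]
      partial_linear[of c "\<lambda>c. partial c \<phi> 0" 0 w]
    by (simp add: dirD_def partial_def)
  moreover have "partial c \<phi> w = partial c \<phi> 0" for c w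
    by (rule constant_of_partial_zero[OF diff(2) zero])
  ultimately have "?\<psi> w = ?\<psi> 0"
    by (intro constant_of_partial_zero differentiable_diff diff lin) simp
  then show ?thesis by simp
qed

lemma s_first_order_imp_second_partials_zero:
  assumes "first_order U I (s_fun f a b)" "q \<in> U" "t \<in> I"
  shows "partial c (\<lambda>w'. partial a (\<lambda>w''. f b w'' v q t) w') w = 0"
proof -
  have "s_fun f a b (axis c 1) w v q t = s_fun f a b 0 w v q t"
    using assms unfolding first_order_def by blast
  then show ?thesis
    by (simp add: s_fun_def total_deriv_def sum_axis_mult)
qed

lemma partial_w_eq_dirD:
  "partial c (\<lambda>w'. F w' v q t) w = dirD (axis c 1, 0) (\<lambda>(w, v, q, t). F w v q t) (w, v, q, t)"
  by (simp add: partial_def dirD_def)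

lemma first_order_s_imp_affine:
  fixes f :: "'n::finite \<Rightarrow> real^'n \<Rightarrow> real^'n \<Rightarrow> real^'n \<Rightarrow> real \<Rightarrow> real"
  assumes "open U" "open I" "smooth_on (UNIV \<times> UNIV \<times> U \<times> I) (\<lambda>(w, v, q, t). f b w v q t)"
    and "\<And>a. first_order U I (s_fun f a b)" "q \<in> U" "t \<in> I"
  shows "f b w v q t = (\<Sum>c\<in>UNIV. partial c (\<lambda>w. f b w v q t) 0 * w $ c) + f b 0 v q t"
proof (rule affine_of_second_partials_zero)
  let ?T = "UNIV \<times> UNIV \<times> U \<times> I" and ?F = "\<lambda>(w, v, q, t). f b w v q t"
  have open_T: "open ?T" using assms by (intro open_Times open_UNIV)
  have D: "(\<lambda>w. X (w, v, q, t)) differentiable at w"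
    if "smooth_on ?T X" for w and X :: "_ \<Rightarrow> real"
  proof -
    have "((\<lambda>w. (w, v, q, t)) has_derivative (\<lambda>e. (e, 0, 0, 0))) (at w)"
      by (auto intro!: derivative_eq_intros simp: zero_prod_def)
    moreover have "X differentiable at (w, v, q, t)"
      using that assms by (intro smooth_on_differentiable) auto
    ultimately show ?thesis
      using has_derivative_compose has_derivative_dirD unfolding differentiable_def by blast
  qed
  show "(\<lambda>w. f b w v q t) differentiable at w" for w
    using D[OF assms(3)] by simp
  show "partial c (\<lambda>w. f b w v q t) differentiable at w" for c w
    using D[OF smooth_on_dirD[OF open_T assms(3), of "(axis c 1, 0)"], of w]
    by (simp flip: partial_w_eq_dirD)
  show "partial d (partial c (\<lambda>w. f b w v q t)) w = 0" for c d w
    by (rule s_first_order_imp_second_partials_zero[OF assms(4-6)])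
qed

lemma (in affine_force) condition_A_iff_partial:
  "condition_A U I f \<longleftrightarrow>
    (\<forall>a b c v. \<forall>q\<in>U. \<forall>t\<in>I.
       partial c (\<lambda>v'. G a b (v', q, t)) v - partial b (\<lambda>v'. G a c (v', q, t)) v = 0) \<and>
    (\<forall>a b c v. \<forall>q\<in>U. \<forall>t\<in>I.
       partial b (\<lambda>v'. partial c (\<lambda>v''. H a (v'', q, t)) v') v
       - partial a (\<lambda>v'. partial c (\<lambda>v''. H b (v'', q, t)) v') v =
       2 * (partial b (\<lambda>q'. G a c (v, q', t)) q - partial a (\<lambda>q'. G b c (v, q', t)) q)) \<and>
    (\<forall>a b c v. \<forall>q\<in>U. \<forall>t\<in>I.
       cyclic_sum (\<lambda>a b c.
         partial b (\<lambda>q'. partial c (\<lambda>v'. H a (v', q', t)) v) q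
         - partial c (\<lambda>q'. partial b (\<lambda>v'. H a (v', q', t)) v) q) a b c = 0)"
  unfolding condition_A_iff first_condition_def second_condition_def third_condition_def
  by (simp add: partial_eq_dirD S_def)

lemma (in affine_force) condition_A_imp_condition_B:
  assumes "condition_A U I f"
  shows "condition_B U I f"
  unfolding condition_B_def
proof (intro exI conjI)
  show "\<forall>a b. smooth_on (UNIV \<times> U \<times> I) (\<lambda>(v, q, t). G a b (v, q, t))"
    "\<forall>a. smooth_on (UNIV \<times> U \<times> I) (\<lambda>(v, q, t). H a (v, q, t))"
    using smooth_G smooth_H by (simp_all add: S_def)
  show "\<forall>a w v. \<forall>q\<in>U. \<forall>t\<in>I. f a w v q t = (\<Sum>b\<in>UNIV. G a b (v, q, t) * w $ b) + H a (v, q, t)"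
    using f_eq by (simp add: S_def)
  show "\<forall>a b v. \<forall>q\<in>U. \<forall>t\<in>I. G a b (v, q, t) = G b a (v, q, t)"
    by (simp add: S_def G_sym)
qed (use assms[unfolded condition_A_iff_partial] in blast)+

lemma condition_A_imp_affine_force:
  fixes U :: "(real^'n::finite) set" and I :: "real set"
    and f :: "'n \<Rightarrow> real^'n \<Rightarrow> real^'n \<Rightarrow> real^'n \<Rightarrow> real \<Rightarrow> real"
  assumes "open U" "open I"
    and smooth: "\<And>a. smooth_on (UNIV \<times> UNIV \<times> U \<times> I) (\<lambda>(w, v, q, t). f a w v q t)"
    and A: "condition_A U I f"
  shows "affine_force U I f (\<lambda>a b (v, q, t). partial b (\<lambda>w. f a w v q t) 0) (\<lambda>a (v, q, t). f a 0 v q t)"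
proof
  let ?T = "UNIV \<times> UNIV \<times> U \<times> I" and ?S = "UNIV \<times> U \<times> I"
  let ?F = "\<lambda>a (w, v, q, t). f a w v q t"
  have opens: "open ?S" "open ?T" by (intro open_Times open_UNIV assms)+
  have restrict: "smooth_on ?S (\<lambda>p. X (0, p))" if "smooth_on ?T X" for X :: "_ \<Rightarrow> real"
    by (rule smooth_on_compose_linear[OF _ opens(1) _ that])
       (auto intro!: bounded_linear_Pair bounded_linear_zero bounded_linear_ident)
  show "smooth_on ?S (\<lambda>(v, q, t). f a 0 v q t)" for a
    using restrict[OF smooth, of a] by (simp add: case_prod_unfold)
  have "(\<lambda>(v, q, t). partial b (\<lambda>w. f a w v q t) 0) = (\<lambda>p. dirD (axis b 1, 0) (?F a) (0, p))" for a b
    by (auto simp: partial_w_eq_dirD)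
  then show "smooth_on ?S (\<lambda>(v, q, t). partial b (\<lambda>w. f a w v q t) 0)" for a b
    using restrict[OF smooth_on_dirD[OF opens(2) smooth]] by simp
  show "f a w v q t = (\<Sum>b\<in>UNIV. (case (v, q, t) of (v, q, t) \<Rightarrow> partial b (\<lambda>w. f a w v q t) 0) * w $ b)
      + (case (v, q, t) of (v, q, t) \<Rightarrow> f a 0 v q t)" if "(v, q, t) \<in> ?S" for a w v q t
    using first_order_s_imp_affine[where f = f and b = a, OF assms(1,2) smooth, of q t w v] A that unfolding condition_A_def by simp
  show "(case p of (v, q, t) \<Rightarrow> partial b (\<lambda>w. f a w v q t) 0)
      = (case p of (v, q, t) \<Rightarrow> partial a (\<lambda>w. f b w v q t) 0)" if "p \<in> ?S" for a b p
    using A that unfolding condition_A_def by auto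
qed (use assms in auto)

theorem mainTheorem3:
  fixes U :: "(real^'n::finite) set" and I :: "real set"
    and f :: "'n \<Rightarrow> real^'n \<Rightarrow> real^'n \<Rightarrow> real^'n \<Rightarrow> real \<Rightarrow> real"
  assumes "open U" and "open I" and "is_interval I"
    and "\<And>a. smooth_on (UNIV \<times> UNIV \<times> U \<times> I) (\<lambda>(w, v, q, t). f a w v q t)"
  shows "condition_A U I f \<longleftrightarrow> condition_B U I f"
proof
  assume A: "condition_A U I f"
  show "condition_B U I f"
    using condition_A_imp_affine_force[OF assms(1,2,4) A] A
    by (rule affine_force.condition_A_imp_condition_B)
next
  assume "condition_B U I f"
  then obtain g h where gh:
    "\<And>a b. smooth_on (UNIV \<times> U \<times> I) (\<lambda>(v, q, t). g a b v q t)"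
    "\<And>a. smooth_on (UNIV \<times> U \<times> I) (\<lambda>(v, q, t). h a v q t)"
    "\<forall>a w v. \<forall>q\<in>U. \<forall>t\<in>I. f a w v q t = (\<Sum>b\<in>UNIV. g a b v q t * w $ b) + h a v q t"
    "\<forall>a b v. \<forall>q\<in>U. \<forall>t\<in>I. g a b v q t = g b a v q t"
    and B: "\<forall>a b c v. \<forall>q\<in>U. \<forall>t\<in>I.
       partial c (\<lambda>v'. g a b v' q t) v - partial b (\<lambda>v'. g a c v' q t) v = 0"
    "\<forall>a b c v. \<forall>q\<in>U. \<forall>t\<in>I.
       partial b (\<lambda>v'. partial c (\<lambda>v''. h a v'' q t) v') v
       - partial a (\<lambda>v'. partial c (\<lambda>v''. h b v'' q t) v') v =
       2 * (partial b (\<lambda>q'. g a c v q' t) q - partial a (\<lambda>q'. g b c v q' t) q)"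
    "\<forall>a b c v. \<forall>q\<in>U. \<forall>t\<in>I.
       cyclic_sum (\<lambda>a b c.
         partial b (\<lambda>q'. partial c (\<lambda>v'. h a v' q' t) v) q
         - partial c (\<lambda>q'. partial b (\<lambda>v'. h a v' q' t) v) q) a b c = 0"
    unfolding condition_B_def by (elim exE conjE) blast
  have force: "affine_force U I f (\<lambda>a b (v, q, t). g a b v q t) (\<lambda>a (v, q, t). h a v q t)"
    by unfold_locales (use gh assms in auto)
  show "condition_A U I f"
    unfolding affine_force.condition_A_iff_partial[OF force] prod.case by (intro conjI B)
qed

end
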